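(* Let $X\in\mathbb{R}^{n\times p}$ be a centered data matrix with columns $X_1,\dots,X_p$, and let $a,k$ be positive integers with $a\le n$, $k\le p$. Consider the problem $$(P)\qquad \max_{s\in\{0,1\}^p,\;U\in\mathbb{R}^{n\times a}}\ \sum_{i=1}^p s_i\sum_{j=1}^a (X_i^TU_j)^2\quad\text{s.t.}\quad \sum_{i=1}^p s_i\le k,\ \ U^TU=I_a,$$ and Algorithm 2 as described in the context, with parameters $\eta^0$ (large enough), $\delta>0$ and $\lambda$. Then: (i) Algorithm 2 converges, i.e. the sequence of values $f(\eta^* )$ held after its successive iterations converges (extended by its last value if the algorithm stops). (ii) For $\delta>0$ small enough, Algorithm 2 finds an optimal solution of $(P)$ in a finite number of steps for $\lambda$ large enough. That is, there exist $\delta_0>0$ and $\bar\eta\ge 0$ such that for all $\delta\in(0,\delta_0]$ and $\eta^0\ge\bar\eta$ there is $\lambda_0$ such that for every $\lambda\ge\lambda_0$ the support $s^*$ returned by Algorithm 2 is an optimal solution of $(P)$.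
   Context: $[p]=\{1,\dots,p\}$. For $s\in\{0,1\}^p$, $X(s)$ is the matrix obtained from $X$ by deleting every column $X_i$ with $s_i=0$ (empty matrix of norm $0$ if $s=0$). $U[s]$ is any element of $\operatorname{argmax}\{\mathrm{tr}(U^TX(s)X(s)^TU): U\in\mathbb{R}^{n\times a},\ U^TU=I_a\}$; $\eta(s)=\|X(s)-U[s]U[s]^TX(s)\|_F^2$ and $\pi(s)=\|U[s]U[s]^TX(s)\|_F^2$, with $\|\cdot\|_F$ the Frobenius norm. A vector $s$ is called an optimal solution of $(P)$ if $(s,U[s])$ is optimal for $(P)$. Centered means that each column of $X$ sums to zero. Algorithm 1 (input: a parameter $\eta$ and a set of cuts, i.e. linear inequalities of the form $\sum_{i\in\sigma}s_i\le|\sigma|-1$ with $\sigma\subset[p]$). Let $\phi$ be the problem of maximizing $\sum_{i=1}^p s_i\|X_i\|^2$ over $s\in\{0,1\}^p$ subject to $\sum_i s_i\le k$ and the input cuts. Compute an optimal solution $s$ of $\phi$. While $\eta(s)>\eta$: add to $\phi$ the cut $\sum_{i\in\sigma}s_i\le|\sigma|-1$ with $\sigma=\{i:s_i=1\}$ for the current $s$, and recompute an optimal solution $s$ of $\phi$. Return $s$. Algorithm 2 (parameters $\eta^0,\delta,\lambda$). Start with $\eta^*=\eta^0$ and counter $c=0$. For $t=0,1,2,\dots$, while $c\le\lambda$: run Algorithm 1 with parameter $\eta^t$ and all cuts generated so far, obtaining a support $s^t$, and let $f(\eta^t)=\pi(s^t)$; if $f(\eta^* )<f(\eta^t)$, set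 $\eta^*:=\eta^t$; set $\eta^{t+1}:=\eta(s^t)-\delta$ and $c:=c+1$. Return $s^*,\eta^*,f(\eta^* )$, where $s^*$ is the support $s^t$ found for $\eta^t=\eta^*$. If the problem $\phi$ becomes infeasible, the algorithm stops and returns the current $s^*,\eta^*,f(\eta^* )$. *)

theory Defs
  imports
    Complex_Main
    "HOL-Library.Extended_Nat"
    "Jordan_Normal_Form.Matrix"
begin

definition centered :: "real mat \<Rightarrow> bool" where
  "centered X \<longleftrightarrow> (\<forall>j<dim_col X. (\<Sum>i<dim_row X. X $$ (i, j)) = 0)"

definition mtrace :: "real mat \<Rightarrow> real" where
  "mtrace A = (\<Sum>i<dim_row A. A $$ (i, i))"

definition frob_norm :: "real mat \<Rightarrow> real" where
  "frob_norm A = sqrt (\<Sum>i<dim_row A. \<Sum>j<dim_col A. (A $$ (i, j))\<^sup>2)"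

definition binary_vecs :: "nat \<Rightarrow> real vec set" where
  "binary_vecs p = {s \<in> carrier_vec p. \<forall>i<p. s $ i \<in> {0, 1}}"

definition support :: "real vec \<Rightarrow> nat set" where
  "support s = {i. i < dim_vec s \<and> s $ i = 1}"

definition select_cols :: "real mat \<Rightarrow> real vec \<Rightarrow> real mat" where
  "select_cols X s =
     mat_of_cols (dim_row X) (map (col X) (filter (\<lambda>i. s $ i \<noteq> 0) [0..<dim_col X]))"

definition orthonormal_cols :: "nat \<Rightarrow> nat \<Rightarrow> real mat \<Rightarrow> bool" where
  "orthonormal_cols n a U \<longleftrightarrow> U \<in> carrier_mat n a \<and> U\<^sup>T * U = 1\<^sub>m a"

definition P_feasible :: "real mat \<Rightarrow> nat \<Rightarrow> nat \<Rightarrow> real vec \<times> real mat \<Rightarrow> bool" where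
  "P_feasible X a k = (\<lambda>(s, U).
     s \<in> binary_vecs (dim_col X) \<and> (\<Sum>i<dim_col X. s $ i) \<le> real k \<and>
     orthonormal_cols (dim_row X) a U)"

definition P_objective :: "real mat \<Rightarrow> nat \<Rightarrow> real vec \<times> real mat \<Rightarrow> real" where
  "P_objective X a = (\<lambda>(s, U).
     \<Sum>i<dim_col X. s $ i * (\<Sum>j<a. (col X i \<bullet> col U j)\<^sup>2))"

definition P_optimal :: "real mat \<Rightarrow> nat \<Rightarrow> nat \<Rightarrow> real vec \<times> real mat \<Rightarrow> bool" where
  "P_optimal X a k = is_arg_max (P_objective X a) (P_feasible X a k)"

text \<open>The argument \<open>Us\<close> maps every \<open>s\<close> to a choice of \<open>U[s]\<close>.\<close>

definition best_frames :: "real mat \<Rightarrow> nat \<Rightarrow> (real vec \<Rightarrow> real mat) \<Rightarrow> bool" where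
  "best_frames X a Us \<longleftrightarrow> (\<forall>s \<in> binary_vecs (dim_col X).
     is_arg_max (\<lambda>U. mtrace (U\<^sup>T * select_cols X s * (select_cols X s)\<^sup>T * U))
       (orthonormal_cols (dim_row X) a) (Us s))"

definition residual :: "real mat \<Rightarrow> (real vec \<Rightarrow> real mat) \<Rightarrow> real vec \<Rightarrow> real" where
  "residual X Us s =
     (frob_norm (select_cols X s - Us s * (Us s)\<^sup>T * select_cols X s))\<^sup>2"

definition captured :: "real mat \<Rightarrow> (real vec \<Rightarrow> real mat) \<Rightarrow> real vec \<Rightarrow> real" where
  "captured X Us s = (frob_norm (Us s * (Us s)\<^sup>T * select_cols X s))\<^sup>2"

text \<open>
  A cut is represented by its index set \<open>\<sigma>\<close>.  The bound \<open>\<bar>\<sigma>\<bar> - 1\<close> is taken in the reals,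
  so that the cut for \<open>\<sigma> = {}\<close> reads \<open>0 \<le> - 1\<close> and makes the problem infeasible.
\<close>

definition phi_feasible :: "nat \<Rightarrow> nat \<Rightarrow> nat set set \<Rightarrow> real vec \<Rightarrow> bool" where
  "phi_feasible p k C s \<longleftrightarrow> s \<in> binary_vecs p \<and> (\<Sum>i<p. s $ i) \<le> real k \<and>
     (\<forall>\<sigma>\<in>C. (\<Sum>i\<in>\<sigma>. s $ i) \<le> real (card \<sigma>) - 1)"

definition phi_objective :: "real mat \<Rightarrow> real vec \<Rightarrow> real" where
  "phi_objective X s = (\<Sum>i<dim_col X. s $ i * (col X i \<bullet> col X i))"

text \<open>
  A solver returns, for each set of cuts, some optimal solution of the problem with these cuts,
  or \<open>None\<close> if that problem is infeasible.
\<close>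

definition phi_solver :: "real mat \<Rightarrow> nat \<Rightarrow> (nat set set \<Rightarrow> real vec option) \<Rightarrow> bool" where
  "phi_solver X k sol \<longleftrightarrow> (\<forall>C \<subseteq> Pow {..<dim_col X}.
     case sol C of
       None \<Rightarrow> \<not> (\<exists>s. phi_feasible (dim_col X) k C s)
     | Some s \<Rightarrow> is_arg_max (phi_objective X) (phi_feasible (dim_col X) k C) s)"

text \<open>
  The result consists of the final set of cuts and the support found, or \<open>None\<close> instead of the
  support if the problem has become infeasible.  The outer option type models termination:
  a diverging computation has the value \<open>None\<close>.
\<close>

partial_function (option) algorithm1 ::
  "real mat \<Rightarrow> (real vec \<Rightarrow> real mat) \<Rightarrow> (nat set set \<Rightarrow> real vec option) \<Rightarrow> real \<Rightarrow>
   nat set set \<Rightarrow> (nat set set \<times> real vec option) option" where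
  "algorithm1 X Us sol \<eta> C =
     (case sol C of
        None \<Rightarrow> Some (C, None)
      | Some s \<Rightarrow>
          if residual X Us s > \<eta> then algorithm1 X Us sol \<eta> (insert (support s) C)
          else Some (C, Some s))"

text \<open>
  State of the second algorithm: \<open>found\<close> records the supports obtained for the parameters tried
  so far, so that \<open>f(\<eta>)\<close> is the captured value of the support \<open>found \<eta>\<close>.
  The counter \<open>cnt\<close> equals the index \<open>t\<close> of the iteration.
\<close>

record state =
  cnt :: nat
  param :: real
  best_param :: real
  found :: "real \<Rightarrow> real vec option"
  cuts :: "nat set set"
  infeasible :: bool

definition initial_state :: "real \<Rightarrow> state" where
  "initial_state \<eta>0 =
     \<lparr>cnt = 0, param = \<eta>0, best_param = \<eta>0, found = Map.empty, cuts = {}, infeasible = False\<rparr>"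

definition f_value ::
  "real mat \<Rightarrow> (real vec \<Rightarrow> real mat) \<Rightarrow> (real \<Rightarrow> real vec option) \<Rightarrow> real \<Rightarrow> real option" where
  "f_value X Us F \<eta> = map_option (captured X Us) (F \<eta>)"

text \<open>
  Different iterations use different solvers \<open>sol t\<close>, and within one run of the first algorithm
  no set of cuts occurs twice; hence ties between optimal solutions may be broken differently
  each time the problem is solved.
\<close>

definition iteration ::
  "real mat \<Rightarrow> (real vec \<Rightarrow> real mat) \<Rightarrow> (nat \<Rightarrow> nat set set \<Rightarrow> real vec option) \<Rightarrow> real \<Rightarrow>
   state \<Rightarrow> state option" where
  "iteration X Us sol \<delta> st =
     map_option
       (\<lambda>(C, r). case r of
          None \<Rightarrow> st\<lparr>cuts := C, infeasible := True\<rparr>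
        | Some s \<Rightarrow>
            let F = (found st)(param st \<mapsto> s);
                better = (the (f_value X Us F (best_param st)) < the (f_value X Us F (param st)))
            in \<lparr>cnt = cnt st + 1,
                param = residual X Us s - \<delta>,
                best_param = (if better then param st else best_param st),
                found = F,
                cuts = C,
                infeasible = False\<rparr>)
       (algorithm1 X Us (sol (cnt st)) (param st) (cuts st))"

text \<open>The parameter \<open>L\<close> bounds the counter; \<open>L = \<infinity>\<close> means that the number of iterations is not limited.\<close>

definition running :: "enat \<Rightarrow> state \<Rightarrow> bool" where
  "running L st \<longleftrightarrow> enat (cnt st) \<le> L \<and> \<not> infeasible st"

partial_function (option) algorithm2_loop ::
  "real mat \<Rightarrow> (real vec \<Rightarrow> real mat) \<Rightarrow> (nat \<Rightarrow> nat set set \<Rightarrow> real vec option) \<Rightarrow> real \<Rightarrow> enat \<Rightarrow>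
   state \<Rightarrow> state option" where
  "algorithm2_loop X Us sol \<delta> L st =
     (if running L st
      then Option.bind (iteration X Us sol \<delta> st) (algorithm2_loop X Us sol \<delta> L)
      else Some st)"

text \<open>
  The result \<open>(s*, \<eta>*, f(\<eta>*))\<close>; it is \<open>None\<close> if the computation diverges or if no support has
  been found at all.
\<close>

definition algorithm2 ::
  "real mat \<Rightarrow> (real vec \<Rightarrow> real mat) \<Rightarrow> (nat \<Rightarrow> nat set set \<Rightarrow> real vec option) \<Rightarrow>
   real \<Rightarrow> real \<Rightarrow> enat \<Rightarrow> (real vec \<times> real \<times> real) option" where
  "algorithm2 X Us sol \<eta>0 \<delta> L =
     Option.bind (algorithm2_loop X Us sol \<delta> L (initial_state \<eta>0))
       (\<lambda>st. map_option (\<lambda>s. (s, best_param st, captured X Us s)) (found st (best_param st)))"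

text \<open>The state after at most \<open>m\<close> iterations, constant in \<open>m\<close> once the algorithm has stopped.\<close>

primrec state_after ::
  "real mat \<Rightarrow> (real vec \<Rightarrow> real mat) \<Rightarrow> (nat \<Rightarrow> nat set set \<Rightarrow> real vec option) \<Rightarrow>
   real \<Rightarrow> real \<Rightarrow> enat \<Rightarrow> nat \<Rightarrow> state option" where
  "state_after X Us sol \<eta>0 \<delta> L 0 = Some (initial_state \<eta>0)"
| "state_after X Us sol \<eta>0 \<delta> L (Suc m) =
     Option.bind (state_after X Us sol \<eta>0 \<delta> L m)
       (\<lambda>st. if running L st then iteration X Us sol \<delta> st else Some st)"

definition best_value_after ::
  "real mat \<Rightarrow> (real vec \<Rightarrow> real mat) \<Rightarrow> (nat \<Rightarrow> nat set set \<Rightarrow> real vec option) \<Rightarrow>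
   real \<Rightarrow> real \<Rightarrow> enat \<Rightarrow> nat \<Rightarrow> real option" where
  "best_value_after X Us sol \<eta>0 \<delta> L m =
     Option.bind (state_after X Us sol \<eta>0 \<delta> L m) (\<lambda>st. f_value X Us (found st) (best_param st))"

end

theory Submission
  imports Defs
begin

text \<open>
  For a support vector \<open>s\<close> the residual \<open>\<eta>(s)\<close> and the captured value \<open>\<pi>(s)\<close> add up to the
  objective of \<open>\<phi>\<close>, and \<open>\<eta>\<close> is monotone in the support, so a cut only removes vectors whose
  residual exceeds the current parameter; for large \<open>\<eta>\<^sup>0\<close> the first iteration removes none.
  Suppose \<open>s\<close> is removed in iteration \<open>t + 1\<close>, i.e. it is still feasible when \<open>u\<close> is found in
  iteration \<open>t\<close>, and \<open>\<eta>(s) > \<eta>(u) - \<delta>\<close>.  If \<open>\<delta>\<close> is at most the smallest gap between residuals,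
  then \<open>\<eta>(s) \<ge> \<eta>(u)\<close>; as \<open>u\<close> maximizes \<open>\<eta> + \<pi>\<close> among the remaining vectors, \<open>\<pi>(s) \<le> \<pi>(u)\<close>.
  Hence no removed vector beats the best one recorded.  The parameter drops by at least \<open>\<delta>\<close> per
  iteration and \<open>\<eta> \<ge> 0\<close>, so eventually every vector is removed and the recorded one is optimal.
\<close>

section \<open>Frobenius norms, traces and orthogonal projections\<close>

lemma frob_norm_sq: "(frob_norm A)\<^sup>2 = (\<Sum>i<dim_row A. \<Sum>j<dim_col A. (A $$ (i, j))\<^sup>2)"
  unfolding frob_norm_def by (intro real_sqrt_pow2 sum_nonneg) auto

lemma frob_norm_sq_mtrace: "(frob_norm A)\<^sup>2 = mtrace (A * A\<^sup>T)"
  unfolding frob_norm_sq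
  by (auto simp: mtrace_def scalar_prod_def atLeast0LessThan power2_eq_square intro!: sum.cong)

lemma frob_norm_sq_mtrace': "(frob_norm A)\<^sup>2 = mtrace (A\<^sup>T * A)"
proof -
  have "(frob_norm A)\<^sup>2 = (\<Sum>j<dim_col A. \<Sum>i<dim_row A. (A $$ (i, j))\<^sup>2)"
    unfolding frob_norm_sq by (rule sum.swap)
  also have "\<dots> = mtrace (A\<^sup>T * A)"
    by (auto simp: mtrace_def scalar_prod_def atLeast0LessThan power2_eq_square intro!: sum.cong)
  finally show ?thesis .
qed

lemma mtrace_minus:
  assumes "A \<in> carrier_mat m m" "B \<in> carrier_mat m m"
  shows "mtrace (A - B) = mtrace A - mtrace B"
  using assms by (simp add: mtrace_def sum_subtractf)

text \<open>Writing the projection of \<open>Y\<close> as \<open>U * Z\<close> with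
  \<open>Z = U\<^sup>T * Y\<close>, the factor \<open>U\<^sup>T * U = 1\<^sub>m a\<close> cancels in
  each product.\<close>

lemma projection_gram:
  assumes U: "orthonormal_cols n a U" and Y: "Y \<in> carrier_mat n m"
  shows "(U * U\<^sup>T * Y)\<^sup>T * (U * U\<^sup>T * Y) = (U\<^sup>T * Y)\<^sup>T * (U\<^sup>T * Y)"
    and "Y\<^sup>T * (U * U\<^sup>T * Y) = (U\<^sup>T * Y)\<^sup>T * (U\<^sup>T * Y)"
    and "(U * U\<^sup>T * Y)\<^sup>T * Y = (U\<^sup>T * Y)\<^sup>T * (U\<^sup>T * Y)"
proof -
  define Z where "Z = U\<^sup>T * Y"
  have c: "U \<in> carrier_mat n a" "U\<^sup>T \<in> carrier_mat a n" "Y\<^sup>T \<in> carrier_mat m n"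
    and orth: "U\<^sup>T * U = 1\<^sub>m a"
    using U Y by (auto simp: orthonormal_cols_def)
  have Z: "Z \<in> carrier_mat a m" "Z\<^sup>T \<in> carrier_mat m a"
    using c Y unfolding Z_def by auto
  have A: "U * U\<^sup>T * Y = U * Z" unfolding Z_def using assoc_mult_mat[OF c(1,2) Y] .
  have AT: "(U * Z)\<^sup>T = Z\<^sup>T * U\<^sup>T" using transpose_mult[OF c(1) Z(1)] .
  have ZT: "Z\<^sup>T = Y\<^sup>T * U" unfolding Z_def using transpose_mult[OF c(2) Y] by simp
  have UZ: "U * Z \<in> carrier_mat n m" using c Z by auto
  have "(U * Z)\<^sup>T * (U * Z) = Z\<^sup>T * (U\<^sup>T * (U * Z))"
    unfolding AT using assoc_mult_mat[OF Z(2) c(2) UZ] .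
  also have "U\<^sup>T * (U * Z) = Z"
    using assoc_mult_mat[OF c(2,1) Z(1)] orth left_mult_one_mat[OF Z(1)] by simp
  finally show "(U * U\<^sup>T * Y)\<^sup>T * (U * U\<^sup>T * Y) = (U\<^sup>T * Y)\<^sup>T * (U\<^sup>T * Y)"
    unfolding A Z_def .
  show "Y\<^sup>T * (U * U\<^sup>T * Y) = (U\<^sup>T * Y)\<^sup>T * (U\<^sup>T * Y)"
    unfolding A Z_def[symmetric] ZT using assoc_mult_mat[OF c(3,1) Z(1)] by simp
  show "(U * U\<^sup>T * Y)\<^sup>T * Y = (U\<^sup>T * Y)\<^sup>T * (U\<^sup>T * Y)"
    unfolding A AT Z_def[symmetric] using assoc_mult_mat[OF Z(2) c(2) Y] by (simp add: Z_def)
qed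

lemma frob_norm_projection:
  assumes "orthonormal_cols n a U" and "Y \<in> carrier_mat n m"
  shows "(frob_norm (U * U\<^sup>T * Y))\<^sup>2 = (frob_norm (U\<^sup>T * Y))\<^sup>2"
  unfolding frob_norm_sq_mtrace' projection_gram(1)[OF assms] ..

text \<open>Pythagoras, proved for Gram matrices before taking traces.\<close>

lemma frob_norm_projection_residual:
  assumes U: "orthonormal_cols n a U" and Y: "Y \<in> carrier_mat n m"
  shows "(frob_norm (Y - U * U\<^sup>T * Y))\<^sup>2 = (frob_norm Y)\<^sup>2 - (frob_norm (U\<^sup>T * Y))\<^sup>2"
proof -
  define A where "A = U * U\<^sup>T * Y"
  have A: "A \<in> carrier_mat n m" using U Y by (auto simp: A_def orthonormal_cols_def)
  have "(Y - A)\<^sup>T * (Y - A) = (Y\<^sup>T - A\<^sup>T) * (Y - A)"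
    using transpose_minus[OF Y A] by simp
  also have "\<dots> = Y\<^sup>T * (Y - A) - A\<^sup>T * (Y - A)"
    by (rule minus_mult_distrib_mat[of _ m n]) (use A Y in auto)
  also have "Y\<^sup>T * (Y - A) = Y\<^sup>T * Y - Y\<^sup>T * A"
    by (rule mult_minus_distrib_mat[of _ m n]) (use A Y in auto)
  also have "A\<^sup>T * (Y - A) = A\<^sup>T * Y - A\<^sup>T * A"
    by (rule mult_minus_distrib_mat[of _ m n]) (use A Y in auto)
  \<comment> \<open>The residual \<open>Y - A\<close> is orthogonal to the projection
    \<open>A\<close>.\<close>
  also have "A\<^sup>T * Y - A\<^sup>T * A = 0\<^sub>m m m"
    using projection_gram[OF U Y] Y A unfolding A_def[symmetric] by auto
  also have "Y\<^sup>T * Y - Y\<^sup>T * A - 0\<^sub>m m m = Y\<^sup>T * Y - Y\<^sup>T * A"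
    using A Y by (intro eq_matI) auto
  finally have "(Y - A)\<^sup>T * (Y - A) = Y\<^sup>T * Y - (U\<^sup>T * Y)\<^sup>T * (U\<^sup>T * Y)"
    using projection_gram[OF U Y] unfolding A_def by simp
  moreover have "Y\<^sup>T * Y \<in> carrier_mat m m" "(U\<^sup>T * Y)\<^sup>T * (U\<^sup>T * Y) \<in> carrier_mat m m"
    using Y by auto
  ultimately show ?thesis
    unfolding frob_norm_sq_mtrace' A_def[symmetric] by (simp only: mtrace_minus)
qed

text \<open>Links the trace maximized in \<open>best_frames\<close> with the norms appearing in the
  projection lemmas.\<close>

lemma frob_norm_mult_mtrace:
  assumes U: "U \<in> carrier_mat n a" and Y: "Y \<in> carrier_mat n m"
  shows "mtrace (U\<^sup>T * Y * Y\<^sup>T * U) = (frob_norm (U\<^sup>T * Y))\<^sup>2"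
proof -
  have "U\<^sup>T * Y * Y\<^sup>T * U = U\<^sup>T * Y * (Y\<^sup>T * U)"
    by (rule assoc_mult_mat[of _ a m _ n]) (use U Y in auto)
  also have "Y\<^sup>T * U = (U\<^sup>T * Y)\<^sup>T"
    using transpose_mult[of "U\<^sup>T" a n Y m] U Y by simp
  finally show ?thesis by (simp add: frob_norm_sq_mtrace)
qed

section \<open>Norms computed column by column, and Bessel's inequality\<close>

lemma frob_norm_sq_cols:
  "(frob_norm (mat_of_cols n vs))\<^sup>2 = (\<Sum>v\<leftarrow>vs. \<Sum>i<n. (v $ i)\<^sup>2)"
proof -
  have "(frob_norm (mat_of_cols n vs))\<^sup>2 = (\<Sum>l<length vs. \<Sum>i<n. ((vs ! l) $ i)\<^sup>2)"
    unfolding frob_norm_sq by (subst sum.swap) (auto simp: mat_of_cols_index intro!: sum.cong)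
  then show ?thesis by (simp add: sum_list_sum_nth atLeast0LessThan)
qed

lemma frob_norm_sq_frame_cols:
  assumes U: "U \<in> carrier_mat n a" and vs: "\<And>v. v \<in> set vs \<Longrightarrow> v \<in> carrier_vec n"
  shows "(frob_norm (U\<^sup>T * mat_of_cols n vs))\<^sup>2 = (\<Sum>v\<leftarrow>vs. \<Sum>j<a. (v \<bullet> col U j)\<^sup>2)"
proof -
  have "(frob_norm (U\<^sup>T * mat_of_cols n vs))\<^sup>2
      = (\<Sum>l<length vs. \<Sum>j<a. (col U j \<bullet> (vs ! l))\<^sup>2)"
    unfolding frob_norm_sq using U vs by (subst sum.swap) (auto intro!: sum.cong)
  also have "\<dots> = (\<Sum>l<length vs. \<Sum>j<a. ((vs ! l) \<bullet> col U j)\<^sup>2)"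
    using U vs by (intro sum.cong refl arg_cong2[where f = power] comm_scalar_prod[of _ n]) auto
  finally show ?thesis by (simp add: sum_list_sum_nth atLeast0LessThan)
qed

text \<open>The difference of the two sides is the squared residual norm of the one-column matrix
  with column \<open>x\<close>.\<close>

lemma Bessel:
  assumes U: "orthonormal_cols n a U" and x: "x \<in> carrier_vec n"
  shows "(\<Sum>j<a. (x \<bullet> col U j)\<^sup>2) \<le> x \<bullet> x"
proof -
  define Y where "Y = mat_of_cols n [x]"
  have Y: "Y \<in> carrier_mat n 1" unfolding Y_def by (rule carrier_matI) simp_all
  have "0 \<le> (frob_norm (Y - U * U\<^sup>T * Y))\<^sup>2" by simp
  also have "\<dots> = (\<Sum>i<n. (x $ i)\<^sup>2) - (\<Sum>j<a. (x \<bullet> col U j)\<^sup>2)"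
    unfolding frob_norm_projection_residual[OF U Y]
    using U x frob_norm_sq_frame_cols[of U n a "[x]"]
    by (simp add: Y_def frob_norm_sq_cols orthonormal_cols_def)
  finally show ?thesis
    using x by (simp add: scalar_prod_def atLeast0LessThan power2_eq_square)
qed

section \<open>Binary vectors, selected columns and cuts\<close>

lemma binary_vecs_cases:
  assumes "s \<in> binary_vecs p" "i < p"
  obtains "s $ i = 0" | "s $ i = 1"
  using assms unfolding binary_vecs_def by auto

text \<open>Trades deleting columns for weighting them with the entries of \<open>s\<close>, the
  form used by both objectives.\<close>

lemma sum_list_select:
  fixes g :: "nat \<Rightarrow> real"
  assumes "s \<in> binary_vecs p"
  shows "(\<Sum>i\<leftarrow>filter (\<lambda>i. s $ i \<noteq> 0) [0..<p]. g i) = (\<Sum>i<p. s $ i * g i)"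
proof -
  have "(\<Sum>i\<leftarrow>filter (\<lambda>i. s $ i \<noteq> 0) [0..<p]. g i)
      = (\<Sum>i\<leftarrow>[0..<p]. if s $ i \<noteq> 0 then g i else 0)"
    by (rule sum_list_map_filter')
  also have "\<dots> = (\<Sum>i<p. if s $ i \<noteq> 0 then g i else 0)"
    by (simp add: interv_sum_list_conv_sum_set_nat atLeast0LessThan)
  also have "\<dots> = (\<Sum>i<p. s $ i * g i)"
    by (intro sum.cong refl) (use assms in \<open>auto elim: binary_vecs_cases\<close>)
  finally show ?thesis .
qed

lemma select_cols_carrier: "select_cols X s \<in> carrier_mat (dim_row X) (dim_col (select_cols X s))"
  by (rule carrier_matI) (simp_all add: select_cols_def)

lemma frob_norm_sq_select_cols:
  assumes "s \<in> binary_vecs (dim_col X)"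
  shows "(frob_norm (select_cols X s))\<^sup>2 = phi_objective X s"
proof -
  have "(frob_norm (select_cols X s))\<^sup>2
      = (\<Sum>i\<leftarrow>filter (\<lambda>i. s $ i \<noteq> 0) [0..<dim_col X]. \<Sum>l<dim_row X. (col X i $ l)\<^sup>2)"
    by (simp add: select_cols_def frob_norm_sq_cols o_def)
  also have "\<dots> = phi_objective X s"
    unfolding sum_list_select[OF assms] phi_objective_def
    by (simp add: scalar_prod_def atLeast0LessThan power2_eq_square)
  finally show ?thesis .
qed

lemma frob_norm_sq_frame_select_cols:
  assumes "s \<in> binary_vecs (dim_col X)" and "U \<in> carrier_mat (dim_row X) a"
  shows "(frob_norm (U\<^sup>T * select_cols X s))\<^sup>2 = P_objective X a (s, U)"
proof -
  have "(frob_norm (U\<^sup>T * select_cols X s))\<^sup>2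
      = (\<Sum>i\<leftarrow>filter (\<lambda>i. s $ i \<noteq> 0) [0..<dim_col X]. \<Sum>j<a. (col X i \<bullet> col U j)\<^sup>2)"
    unfolding select_cols_def using assms(2)
    by (subst frob_norm_sq_frame_cols) (auto simp: o_def)
  also have "\<dots> = P_objective X a (s, U)"
    unfolding sum_list_select[OF assms(1)] P_objective_def by simp
  finally show ?thesis .
qed

lemma finite_binary_vecs: "finite (binary_vecs p)"
proof (rule finite_subset)
  show "binary_vecs p \<subseteq> (\<lambda>A. vec p (\<lambda>i. if i \<in> A then 1 else 0)) ` Pow {..<p}"
  proof
    fix s :: "real vec" assume s: "s \<in> binary_vecs p"
    have "s = vec p (\<lambda>i. if i \<in> support s then 1 else 0)"
      using s by (intro eq_vecI) (auto simp: support_def binary_vecs_def)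
    moreover have "support s \<subseteq> {..<p}" using s by (auto simp: support_def binary_vecs_def)
    ultimately show "s \<in> (\<lambda>A. vec p (\<lambda>i. if i \<in> A then 1 else 0)) ` Pow {..<p}" by blast
  qed
qed simp

lemma support_subset: "s \<in> binary_vecs p \<Longrightarrow> support s \<subseteq> {..<p}"
  by (auto simp: support_def binary_vecs_def)

text \<open>A single zero entry on \<sigma> already lowers the sum to at most
  \<open>card \<sigma> - 1\<close>. In the case \<open>\<sigma> = {}\<close> both sides are true, in
  accordance with the cut \<open>0 \<le> - 1\<close>.\<close>

lemma cut_violated_iff:
  assumes "s \<in> binary_vecs p" "\<sigma> \<subseteq> {..<p}"
  shows "\<not> (\<Sum>i\<in>\<sigma>. s $ i) \<le> real (card \<sigma>) - 1 \<longleftrightarrow> \<sigma> \<subseteq> support s"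
proof
  assume "\<sigma> \<subseteq> support s"
  then have "(\<Sum>i\<in>\<sigma>. s $ i) = (\<Sum>i\<in>\<sigma>. 1)" by (intro sum.cong) (auto simp: support_def)
  then show "\<not> (\<Sum>i\<in>\<sigma>. s $ i) \<le> real (card \<sigma>) - 1" by simp
next
  assume viol: "\<not> (\<Sum>i\<in>\<sigma>. s $ i) \<le> real (card \<sigma>) - 1"
  have fin: "finite \<sigma>" using assms(2) finite_subset by blast
  show "\<sigma> \<subseteq> support s"
  proof (rule ccontr)
    assume "\<not> \<sigma> \<subseteq> support s"
    then obtain i where i: "i \<in> \<sigma>" "i \<notin> support s" by blast
    then have "s $ i = 0" using assms by (auto simp: support_def binary_vecs_def)
    then have "(\<Sum>i\<in>\<sigma>. s $ i) = (\<Sum>i\<in>\<sigma> - {i}. s $ i)" using fin i by (simp add: sum.remove)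
    also have "\<dots> \<le> (\<Sum>i\<in>\<sigma> - {i}. 1)"
      using assms by (intro sum_mono) (auto simp: binary_vecs_def)
    \<comment> \<open>As \<open>i \<in> \<sigma>\<close>, the cardinality is positive, so
      subtraction in the naturals is not truncated.\<close>
    also have "\<dots> = real (card \<sigma>) - 1"
      using fin i card_gt_0_iff[of \<sigma>] by (auto simp: card_Diff_singleton of_nat_diff)
    finally show False using viol by simp
  qed
qed

section \<open>Residual and captured value for optimal frames\<close>

locale frames =
  fixes X :: "real mat" and a k :: nat and Us :: "real vec \<Rightarrow> real mat"
  assumes frames: "best_frames X a Us"
begin

abbreviation "p \<equiv> dim_col X"
abbreviation "\<eta> \<equiv> residual X Us"
abbreviation "\<pi> \<equiv> captured X Us"
abbreviation "feas \<equiv> phi_feasible p k"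

lemma feas_binary: "feas C s \<Longrightarrow> s \<in> binary_vecs p"
  by (simp add: phi_feasible_def)

lemma frame_orthonormal: "s \<in> binary_vecs p \<Longrightarrow> orthonormal_cols (dim_row X) a (Us s)"
  using frames by (simp add: best_frames_def is_arg_max_def)

lemma captured_eq:
  assumes s: "s \<in> binary_vecs p"
  shows "\<pi> s = P_objective X a (s, Us s)"
proof -
  note U = frame_orthonormal[OF s]
  show ?thesis
    unfolding captured_def frob_norm_projection[OF U select_cols_carrier]
    by (rule frob_norm_sq_frame_select_cols[OF s]) (use U in \<open>simp add: orthonormal_cols_def\<close>)
qed

lemma residual_plus_captured:
  assumes s: "s \<in> binary_vecs p"
  shows "\<eta> s + \<pi> s = phi_objective X s"
proof -
  note U = frame_orthonormal[OF s]
  show ?thesis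
    unfolding captured_def residual_def frob_norm_projection[OF U select_cols_carrier]
      frob_norm_projection_residual[OF U select_cols_carrier] frob_norm_sq_select_cols[OF s]
    by (rule diff_add_cancel)
qed

text \<open>For fixed \<open>s\<close> the trace that \<open>Us s\<close> maximizes is the objective
  of (P), so \<open>Us s\<close> is a best completion of \<open>s\<close>.\<close>

lemma P_objective_le_captured:
  assumes s: "s \<in> binary_vecs p" and U: "orthonormal_cols (dim_row X) a U"
  shows "P_objective X a (s, U) \<le> \<pi> s"
proof -
  let ?t = "\<lambda>V. mtrace (V\<^sup>T * select_cols X s * (select_cols X s)\<^sup>T * V)"
  have tr: "?t V = P_objective X a (s, V)" if V: "orthonormal_cols (dim_row X) a V" for V
  proof -
    have V: "V \<in> carrier_mat (dim_row X) a" using V by (simp add: orthonormal_cols_def)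
    show ?thesis
      unfolding frob_norm_mult_mtrace[OF V select_cols_carrier]
      by (rule frob_norm_sq_frame_select_cols[OF s V])
  qed
  have "?t U \<le> ?t (Us s)"
    using frames s U unfolding best_frames_def is_arg_max_def by (meson linorder_not_less)
  then show ?thesis unfolding tr[OF U] tr[OF frame_orthonormal[OF s]] captured_eq[OF s] .
qed

lemma residual_nonneg: "0 \<le> \<eta> s" and captured_nonneg: "0 \<le> \<pi> s"
  by (simp_all add: residual_def captured_def)

text \<open>The cut for \<open>support s\<close> also removes every vector with a larger support;
  by monotonicity all of these have too large a residual as well.\<close>

lemma residual_mono:
  assumes s: "s \<in> binary_vecs p" and s': "s' \<in> binary_vecs p" and sub: "support s \<subseteq> support s'"
  shows "\<eta> s \<le> \<eta> s'"
proof -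
  \<comment> \<open>The frame of the larger support serves both vectors: it is exact for
    \<open>s'\<close> and possibly suboptimal for \<open>s\<close>, where it can only increase the
    residual. The weight \<open>g i\<close> is the squared distance of column \<open>i\<close> from
    its span.\<close>
  define g where "g i = col X i \<bullet> col X i - (\<Sum>j<a. (col X i \<bullet> col (Us s') j)\<^sup>2)" for i
  have eq: "phi_objective X v - P_objective X a (v, Us s') = (\<Sum>i<p. v $ i * g i)" for v
    by (simp add: phi_objective_def P_objective_def g_def right_diff_distrib sum_subtractf)
  have "\<eta> s \<le> phi_objective X s - P_objective X a (s, Us s')"
    using residual_plus_captured[OF s] P_objective_le_captured[OF s frame_orthonormal[OF s']]
    by simp
  also have "\<dots> = (\<Sum>i<p. s $ i * g i)" by (rule eq)
  also have "\<dots> \<le> (\<Sum>i<p. s' $ i * g i)"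
  proof (intro sum_mono mult_right_mono)
    fix i assume i: "i \<in> {..<p}"
    show "s $ i \<le> s' $ i"
    proof (cases "i \<in> support s")
      case True
      with sub show ?thesis by (auto simp: support_def)
    next
      case False
      with i s have "s $ i = 0" by (auto simp: binary_vecs_def support_def)
      with i s' show ?thesis by (auto elim: binary_vecs_cases)
    qed
    show "0 \<le> g i"
      unfolding g_def using Bessel[OF frame_orthonormal[OF s'], of "col X i"] by simp
  qed
  also have "\<dots> = \<eta> s'"
    using eq[of s'] residual_plus_captured[OF s'] captured_eq[OF s'] by simp
  finally show ?thesis .
qed

section \<open>Termination of \<open>algorithm1\<close> and the vectors it cuts off\<close>

lemma phi_solver_cases:
  assumes "phi_solver X k sol" "C \<subseteq> Pow {..<p}"
  obtains "sol C = None" "\<And>s. \<not> feas C s"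
  | s where "sol C = Some s" "is_arg_max (phi_objective X) (feas C) s"
proof -
  have spec: "case sol C of None \<Rightarrow> \<not> (\<exists>s. feas C s)
      | Some s \<Rightarrow> is_arg_max (phi_objective X) (feas C) s"
    using assms unfolding phi_solver_def by blast
  show thesis
  proof (cases "sol C")
    case None
    with spec that(1) show thesis by simp
  next
    case (Some s)
    with spec that(2) show thesis by simp
  qed
qed

lemma algorithm1_result:
  assumes sol: "phi_solver X k sol"
  shows "C \<subseteq> Pow {..<p} \<Longrightarrow> \<exists>C' r. algorithm1 X Us sol e C = Some (C', r) \<and> C' \<subseteq> Pow {..<p} \<and>
    (\<forall>s. feas C s \<longrightarrow> \<not> feas C' s \<longrightarrow> e < \<eta> s) \<and>
    (case r of None \<Rightarrow> \<forall>s. \<not> feas C' s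
     | Some s \<Rightarrow> is_arg_max (phi_objective X) (feas C') s \<and> \<eta> s \<le> e)"
proof (induction "card (Pow {..<p} - C)" arbitrary: C rule: less_induct)
  case less
  show ?case
  proof (cases rule: phi_solver_cases[OF sol less.prems])
    case 1
    then have "algorithm1 X Us sol e C = Some (C, None)" by (subst algorithm1.simps) simp
    with 1 less.prems show ?thesis by auto
  next
    case (2 s)
    then have s: "feas C s" by (simp add: is_arg_max_def)
    note sb = feas_binary[OF s]
    show ?thesis
    proof (cases "e < \<eta> s")
      case False
      with 2 have "algorithm1 X Us sol e C = Some (C, Some s)"
        by (subst algorithm1.simps) simp
      with 2 less.prems False show ?thesis by auto
    next
      case True
      let ?D = "insert (support s) C"
      have unfold: "algorithm1 X Us sol e C = algorithm1 X Us sol e ?D"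
        using 2 True by (subst algorithm1.simps) simp
      have sub: "?D \<subseteq> Pow {..<p}" using less.prems support_subset[OF sb] by auto
      have "support s \<notin> C"
        using s cut_violated_iff[OF sb support_subset[OF sb]] by (auto simp: phi_feasible_def)
      then have "card (Pow {..<p} - ?D) < card (Pow {..<p} - C)"
        using support_subset[OF sb] by (intro psubset_card_mono) auto
      from less.hyps[OF this sub] obtain C' r where r: "algorithm1 X Us sol e ?D = Some (C', r)"
        "C' \<subseteq> Pow {..<p}" "\<And>v. feas ?D v \<Longrightarrow> \<not> feas C' v \<Longrightarrow> e < \<eta> v"
        "case r of None \<Rightarrow> \<forall>s. \<not> feas C' s
         | Some s \<Rightarrow> is_arg_max (phi_objective X) (feas C') s \<and> \<eta> s \<le> e"
        by blast
      \<comment> \<open>Either the new cut removes \<open>v\<close>, and monotonicity of the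
        residual applies, or a later cut does, and the induction hypothesis applies.\<close>
      have "e < \<eta> v" if v: "feas C v" "\<not> feas C' v" for v
      proof (cases "feas ?D v")
        case False
        with v(1) have "support s \<subseteq> support v"
          using cut_violated_iff[OF feas_binary[OF v(1)] support_subset[OF sb]]
          by (auto simp: phi_feasible_def)
        from residual_mono[OF sb feas_binary[OF v(1)] this] True show ?thesis by simp
      qed (use r(3) v in blast)
      then show ?thesis unfolding unfold using r by blast
    qed
  qed
qed

section \<open>Gaps between residuals and the loop invariant\<close>

text \<open>The weak inequality suffices, since cuts remove only residuals strictly above the
  parameter.\<close>

definition separates_residuals :: "real \<Rightarrow> bool" where
  "separates_residuals \<delta> \<longleftrightarrow>
    (\<forall>s s'. feas {} s \<longrightarrow> feas {} s' \<longrightarrow> \<eta> s' < \<eta> s \<longrightarrow> \<eta> s' \<le> \<eta> s - \<delta>)"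

lemma finite_feas: "finite {s. feas {} s}"
  by (rule finite_subset[OF _ finite_binary_vecs[of p]]) (auto simp: phi_feasible_def)

lemma separates_residuals_small: "\<exists>\<delta>0>0. \<forall>\<delta>\<in>{0<..\<delta>0}. separates_residuals \<delta>"
proof -
  \<comment> \<open>The element 1 keeps \<open>D\<close> nonempty when all feasible residuals agree;
    \<open>Min D\<close> then serves as \<open>\<delta>0\<close>.\<close>
  define D where "D = insert 1 ({d. 0 < d} \<inter>
    (\<lambda>(s, s'). \<eta> s - \<eta> s') ` ({s. feas {} s} \<times> {s. feas {} s}))"
  have fin: "finite D" using finite_feas by (simp add: D_def)
  have "0 < Min D" using fin by (subst Min_gr_iff) (auto simp: D_def)
  moreover have "separates_residuals \<delta>" if \<delta>: "\<delta> \<le> Min D" for \<delta>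
    unfolding separates_residuals_def
  proof (intro allI impI)
    fix s s' assume "feas {} s" "feas {} s'" "\<eta> s' < \<eta> s"
    then have "\<eta> s - \<eta> s' \<in> D" unfolding D_def by force
    from Min_le[OF fin this] \<delta> show "\<eta> s' \<le> \<eta> s - \<delta>" by simp
  qed
  ultimately show ?thesis by auto
qed

definition best_support :: "state \<Rightarrow> real vec" where
  "best_support st = the (found st (best_param st))"

text \<open>Meant for states after the first iteration, since initially nothing is found. The
  witness \<open>u\<close> is the support found last. \<open>param st < best_param st\<close>
  protects the best entry of \<open>found\<close> from being overwritten, and the bound by
  \<open>\<eta>0 - real (cnt st) * \<delta>\<close> yields termination. Only the comparison with
  removed vectors needs small \<delta>, so convergence can use the invariant for every positive
  \<delta>.\<close>

definition loop_inv :: "real \<Rightarrow> real \<Rightarrow> state \<Rightarrow> bool" where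
  "loop_inv \<delta> \<eta>0 st \<longleftrightarrow>
     cuts st \<subseteq> Pow {..<p} \<and>
     found st (best_param st) = Some (best_support st) \<and> feas {} (best_support st) \<and>
     (separates_residuals \<delta> \<longrightarrow>
       (\<forall>s. feas {} s \<longrightarrow> \<not> feas (cuts st) s \<longrightarrow> \<pi> s \<le> \<pi> (best_support st))) \<and>
     (if infeasible st then \<forall>s. \<not> feas (cuts st) s
      else param st < best_param st \<and> param st \<le> \<eta>0 - real (cnt st) * \<delta> \<and>
        (\<exists>u. is_arg_max (phi_objective X) (feas (cuts st)) u \<and>
             param st = \<eta> u - \<delta> \<and> \<pi> u \<le> \<pi> (best_support st)))"

lemma feas_empty: "feas C s \<Longrightarrow> feas {} s"
  by (simp add: phi_feasible_def)

text \<open>Both values are nonnegative and add up to \<open>phi_objective X s\<close>, which is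
  largest with all columns present. This bound becomes the threshold for \<open>\<eta>0\<close> and
  the upper bound in the convergence proof.\<close>

lemma residual_le: "s \<in> binary_vecs p \<Longrightarrow> \<eta> s \<le> (\<Sum>i<p. col X i \<bullet> col X i)"
  and captured_le: "s \<in> binary_vecs p \<Longrightarrow> \<pi> s \<le> (\<Sum>i<p. col X i \<bullet> col X i)"
proof -
  assume s: "s \<in> binary_vecs p"
  have "0 \<le> col X i \<bullet> col X i" for i
    by (auto simp: scalar_prod_def intro: sum_nonneg)
  then have "phi_objective X s \<le> (\<Sum>i<p. col X i \<bullet> col X i)"
    unfolding phi_objective_def using s
    by (intro sum_mono mult_left_le_one_le) (auto simp: binary_vecs_def)
  then show "\<eta> s \<le> (\<Sum>i<p. col X i \<bullet> col X i)" "\<pi> s \<le> (\<Sum>i<p. col X i \<bullet> col X i)"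
    using residual_plus_captured[OF s] residual_nonneg[of s] captured_nonneg[of s] by linarith+
qed

section \<open>Single iterations of \<open>algorithm2\<close>\<close>

text \<open>No residual exceeds \<open>\<eta>0\<close>, so no vector is lost, and the zero vector
  shows that the problem is feasible; hence a support is found.\<close>

lemma first_iteration:
  assumes sol: "phi_solver X k (sol 0)" and \<delta>: "0 < \<delta>"
    and \<eta>0: "(\<Sum>i<p. col X i \<bullet> col X i) \<le> \<eta>0"
  shows "\<exists>st. iteration X Us sol \<delta> (initial_state \<eta>0) = Some st \<and> loop_inv \<delta> \<eta>0 st"
proof -
  obtain C r where r: "algorithm1 X Us (sol 0) \<eta>0 {} = Some (C, r)"
    "C \<subseteq> Pow {..<p}" "\<And>s. feas {} s \<Longrightarrow> \<not> feas C s \<Longrightarrow> \<eta>0 < \<eta> s"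
    and cases: "case r of None \<Rightarrow> \<forall>s. \<not> feas C s
      | Some s \<Rightarrow> is_arg_max (phi_objective X) (feas C) s \<and> \<eta> s \<le> \<eta>0"
    using algorithm1_result[OF sol, of "{}" \<eta>0] by blast
  have uncut: "feas C s" if "feas {} s" for s
    using r(3)[OF that] residual_le[OF feas_binary[OF that]] \<eta>0 by linarith
  have "feas {} (0\<^sub>v p)" by (simp add: phi_feasible_def binary_vecs_def)
  with uncut cases obtain s where Some: "r = Some s"
    and s: "is_arg_max (phi_objective X) (feas C) s" "\<eta> s \<le> \<eta>0"
    by (cases r) auto
  define st where "st = \<lparr>cnt = Suc 0, param = \<eta> s - \<delta>, best_param = \<eta>0,
    found = [\<eta>0 \<mapsto> s], cuts = C, infeasible = False\<rparr>"
  \<comment> \<open>Here \<open>param\<close> equals \<open>best_param\<close>: the new value is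
    compared with itself, which is no strict improvement, so \<open>best_param\<close> stays
    \<open>\<eta>0\<close>.\<close>
  have "iteration X Us sol \<delta> (initial_state \<eta>0) = Some st"
    by (simp add: iteration_def initial_state_def r(1) Some st_def f_value_def)
  moreover have best: "best_support st = s" by (simp add: best_support_def st_def)
  have "feas {} s" using s(1) by (auto simp: is_arg_max_def intro: feas_empty)
  then have "loop_inv \<delta> \<eta>0 st"
    unfolding loop_inv_def best using r(2) s \<delta> uncut by (auto simp: st_def)
  ultimately show ?thesis by blast
qed

text \<open>The growth of the best value is needed for convergence, that of the counter for
  termination. The latter excludes infeasible outcomes, which leave the counter unchanged.\<close>

lemma next_iteration:
  assumes sol: "phi_solver X k (sol (cnt st))" and \<delta>: "0 < \<delta>"
    and inv: "loop_inv \<delta> \<eta>0 st" and feasible: "\<not> infeasible st"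
  shows "\<exists>st'. iteration X Us sol \<delta> st = Some st' \<and> loop_inv \<delta> \<eta>0 st' \<and>
    \<pi> (best_support st) \<le> \<pi> (best_support st') \<and> (\<not> infeasible st' \<longrightarrow> cnt st' = Suc (cnt st))"
proof -
  obtain u where C: "cuts st \<subseteq> Pow {..<p}"
    and best: "found st (best_param st) = Some (best_support st)" "feas {} (best_support st)"
    and opt: "\<And>s. separates_residuals \<delta> \<Longrightarrow> feas {} s \<Longrightarrow> \<not> feas (cuts st) s \<Longrightarrow>
      \<pi> s \<le> \<pi> (best_support st)"
    and par: "param st < best_param st" "param st \<le> \<eta>0 - real (cnt st) * \<delta>"
    and u: "is_arg_max (phi_objective X) (feas (cuts st)) u"
      "param st = \<eta> u - \<delta>" "\<pi> u \<le> \<pi> (best_support st)"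
    using inv feasible unfolding loop_inv_def by auto
  obtain C' r where r: "algorithm1 X Us (sol (cnt st)) (param st) (cuts st) = Some (C', r)"
    "C' \<subseteq> Pow {..<p}" "\<And>s. feas (cuts st) s \<Longrightarrow> \<not> feas C' s \<Longrightarrow> param st < \<eta> s"
    and cases: "case r of None \<Rightarrow> \<forall>s. \<not> feas C' s
      | Some s \<Rightarrow> is_arg_max (phi_objective X) (feas C') s \<and> \<eta> s \<le> param st"
    using algorithm1_result[OF sol C] by blast
  have feas_u: "feas (cuts st) u" using u(1) by (simp add: is_arg_max_def)
  \<comment> \<open>Vectors lost in this iteration are compared with the previous support
    \<open>u\<close>; for those lost earlier the invariant applies.\<close>
  have opt': "\<pi> s \<le> \<pi> (best_support st)"
    if sep: "separates_residuals \<delta>" and s: "feas {} s" and cut: "\<not> feas C' s" for s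
  proof (cases "feas (cuts st) s")
    case True
    have "\<eta> u - \<delta> < \<eta> s" using r(3)[OF True cut] u(2) by simp
    with sep s feas_empty[OF feas_u] have "\<eta> u \<le> \<eta> s"
      unfolding separates_residuals_def by (meson linorder_not_less)
    moreover have "phi_objective X s \<le> phi_objective X u"
      using u(1) True by (auto simp: is_arg_max_def)
    ultimately have "\<pi> s \<le> \<pi> u"
      using residual_plus_captured[OF feas_binary[OF s]]
        residual_plus_captured[OF feas_binary[OF feas_u]] by simp
    with u(3) show ?thesis by simp
  qed (use opt sep s in blast)
  show ?thesis
  proof (cases r)
    case None
    then have it: "iteration X Us sol \<delta> st = Some (st\<lparr>cuts := C', infeasible := True\<rparr>)"
      by (simp add: iteration_def r(1))
    show ?thesis unfolding it
      using r(2) best opt' cases None by (simp add: loop_inv_def best_support_def)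
  next
    case (Some s)
    with cases have s: "is_arg_max (phi_objective X) (feas C') s" "\<eta> s \<le> param st" by auto
    then have feas_s: "feas {} s" by (auto simp: is_arg_max_def intro: feas_empty)
    define better where "better \<longleftrightarrow> \<pi> (best_support st) < \<pi> s"
    define st' where "st' = \<lparr>cnt = Suc (cnt st), param = \<eta> s - \<delta>,
      best_param = (if better then param st else best_param st),
      found = (found st)(param st \<mapsto> s), cuts = C', infeasible = False\<rparr>"
    \<comment> \<open>The key \<open>param st\<close> differs from \<open>best_param st\<close>, so
      the update does not disturb the best entry.\<close>
    have it: "iteration X Us sol \<delta> st = Some st'"
      using par(1) best(1)
      by (simp add: iteration_def r(1) Some st'_def better_def f_value_def)
    have best': "best_support st' = (if better then s else best_support st)"
      "found st' (best_param st') = Some (best_support st')"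
      using par(1) best(1) by (auto simp: best_support_def st'_def)
    have le: "\<pi> (best_support st) \<le> \<pi> (best_support st')" "\<pi> s \<le> \<pi> (best_support st')"
      unfolding best' by (auto simp: better_def)
    have "loop_inv \<delta> \<eta>0 st'"
      unfolding loop_inv_def
    proof (intro conjI impI allI)
      show "cuts st' \<subseteq> Pow {..<p}" using r(2) by (simp add: st'_def)
      show "found st' (best_param st') = Some (best_support st')" by fact
      show "feas {} (best_support st')" using best'(1) best(2) feas_s by simp
      show "\<pi> v \<le> \<pi> (best_support st')"
        if "separates_residuals \<delta>" "feas {} v" "\<not> feas (cuts st') v" for v
        using opt'[of v] that le(1) by (simp add: st'_def)
      \<comment> \<open>The new witness is \<open>s\<close>. As
        \<open>\<eta> s \<le> param st\<close>, the parameter drops by at least \<delta>, which also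
        puts it below either choice of \<open>best_param\<close>.\<close>
      show "if infeasible st' then \<forall>s. \<not> feas (cuts st') s
        else param st' < best_param st' \<and> param st' \<le> \<eta>0 - real (cnt st') * \<delta> \<and>
          (\<exists>u. is_arg_max (phi_objective X) (feas (cuts st')) u \<and>
               param st' = \<eta> u - \<delta> \<and> \<pi> u \<le> \<pi> (best_support st'))"
        using s par \<delta> le(2) by (auto simp: st'_def algebra_simps)
    qed
    then show ?thesis using it le(1) by (simp add: st'_def)
  qed
qed

text \<open>Since \<open>Us s\<close> is a best frame for each \<open>s\<close>, (P) reduces to
  maximizing \<pi> over the supports.\<close>

lemma P_optimal_if_captured_max:
  assumes b: "feas {} b" and max: "\<And>s. feas {} s \<Longrightarrow> \<pi> s \<le> \<pi> b"
  shows "P_optimal X a k (b, Us b)"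
  unfolding P_optimal_def is_arg_max_def
proof (intro conjI notI)
  note bb = feas_binary[OF b]
  show "P_feasible X a k (b, Us b)"
    using b frame_orthonormal[OF bb] by (simp add: P_feasible_def phi_feasible_def)
  assume "\<exists>y. P_feasible X a k y \<and> P_objective X a (b, Us b) < P_objective X a y"
  then obtain s U where sU: "P_feasible X a k (s, U)"
    "P_objective X a (b, Us b) < P_objective X a (s, U)" by auto
  then have s: "feas {} s" and U: "orthonormal_cols (dim_row X) a U"
    by (simp_all add: P_feasible_def phi_feasible_def)
  have "P_objective X a (s, U) \<le> \<pi> b"
    using P_objective_le_captured[OF feas_binary[OF s] U] max[OF s] by simp
  with sU(2) show False by (simp add: captured_eq[OF bb])
qed

section \<open>Convergence, termination and optimality of \<open>algorithm2\<close>\<close>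

context
  fixes sol :: "nat \<Rightarrow> nat set set \<Rightarrow> real vec option" and \<delta> \<eta>0 :: real
  assumes sol: "\<And>t. phi_solver X k (sol t)" and \<delta>: "0 < \<delta>"
    and \<eta>0: "(\<Sum>i<p. col X i \<bullet> col X i) \<le> \<eta>0"
begin

lemma running_initial: "running L (initial_state \<eta>0)"
  by (simp add: running_def initial_state_def zero_enat_def[symmetric])

lemma state_after_Suc:
  assumes "state_after X Us sol \<eta>0 \<delta> L m = Some st" "loop_inv \<delta> \<eta>0 st"
  shows "\<exists>st'. state_after X Us sol \<eta>0 \<delta> L (Suc m) = Some st' \<and> loop_inv \<delta> \<eta>0 st' \<and>
    \<pi> (best_support st) \<le> \<pi> (best_support st')"
proof (cases "running L st")
  case True
  with next_iteration[of sol, OF sol \<delta> assms(2)] assms(1) show ?thesis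
    by (auto simp: running_def)
qed (use assms in auto)

lemma state_after_inv: "\<exists>st. state_after X Us sol \<eta>0 \<delta> L (Suc m) = Some st \<and> loop_inv \<delta> \<eta>0 st"
proof (induction m)
  case 0
  show ?case using first_iteration[of sol, OF sol \<delta> \<eta>0] running_initial by simp
next
  case (Suc m)
  then show ?case using state_after_Suc by blast
qed

text \<open>The values are nondecreasing and bounded by the total squared norm of the columns.
  Indices start at \<open>Suc m\<close>, as no value exists before the first iteration.\<close>

lemma best_value_convergent:
  "\<exists>v. (\<forall>m. best_value_after X Us sol \<eta>0 \<delta> L (Suc m) = Some (v m)) \<and> convergent v"
proof -
  obtain S where S: "\<And>m. state_after X Us sol \<eta>0 \<delta> L (Suc m) = Some (S m)"
    "\<And>m. loop_inv \<delta> \<eta>0 (S m)"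
    using state_after_inv[of L] by metis
  define v where "v m = \<pi> (best_support (S m))" for m
  have "best_value_after X Us sol \<eta>0 \<delta> L (Suc m) = Some (v m)" for m
    unfolding best_value_after_def S(1)
    using S(2)[of m] by (simp add: f_value_def v_def loop_inv_def)
  moreover have "incseq v"
  proof (rule incseq_SucI)
    fix m
    show "v m \<le> v (Suc m)"
      using state_after_Suc[OF S, of m] S(1)[of "Suc m"] unfolding v_def by auto
  qed
  moreover have "v m \<le> (\<Sum>i<p. col X i \<bullet> col X i)" for m
    unfolding v_def using S(2)[of m] by (intro captured_le feas_binary) (auto simp: loop_inv_def)
  ultimately show ?thesis
    by (meson convergentI incseq_convergent)
qed

text \<open>While the problem is feasible,
  \<open>\<eta> u - \<delta> \<le> \<eta>0 - real (cnt st) * \<delta>\<close> with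
  \<open>\<eta> u \<ge> 0\<close> keeps the counter below \<open>N\<close>. So the loop ends by
  infeasibility, not by reaching the limit \<open>L\<close>.\<close>

lemma algorithm2_loop_result:
  assumes N: "\<eta>0 + \<delta> < real N * \<delta>" and L: "enat N \<le> L"
  shows "loop_inv \<delta> \<eta>0 st \<Longrightarrow> \<exists>st'. algorithm2_loop X Us sol \<delta> L st = Some st' \<and>
    loop_inv \<delta> \<eta>0 st' \<and> infeasible st'"
proof (induction "N - cnt st" arbitrary: st rule: less_induct)
  case less
  show ?case
  proof (cases "infeasible st")
    case True
    then show ?thesis
      using less.prems by (subst algorithm2_loop.simps) (simp add: running_def)
  next
    case False
    then obtain u where "param st \<le> \<eta>0 - real (cnt st) * \<delta>" "param st = \<eta> u - \<delta>"
      using less.prems by (auto simp: loop_inv_def)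
    then have "real (cnt st) * \<delta> < real N * \<delta>" using N residual_nonneg[of u] by linarith
    then have cnt: "cnt st < N" using \<delta> by simp
    then have "enat (cnt st) \<le> L" by (intro order_trans[OF _ L]) simp
    with False have run: "running L st" by (simp add: running_def)
    obtain st' where st': "iteration X Us sol \<delta> st = Some st'" "loop_inv \<delta> \<eta>0 st'"
      "\<not> infeasible st' \<Longrightarrow> cnt st' = Suc (cnt st)"
      using next_iteration[of sol, OF sol \<delta> less.prems False] by blast
    have eq: "algorithm2_loop X Us sol \<delta> L st = algorithm2_loop X Us sol \<delta> L st'"
      using run st'(1) by (subst algorithm2_loop.simps) simp
    show ?thesis
    proof (cases "infeasible st'")
      case True
      then show ?thesis unfolding eq
        using st'(2) by (subst algorithm2_loop.simps) (simp add: running_def)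
    next
      case False
      with st'(3) cnt have "N - cnt st' < N - cnt st" by simp
      from less.hyps[OF this st'(2)] show ?thesis unfolding eq .
    qed
  qed
qed

text \<open>At the end every vector is cut off, so the invariant compares the recorded support with
  all feasible ones.\<close>

lemma algorithm2_optimal:
  assumes sep: "separates_residuals \<delta>"
    and N: "\<eta>0 + \<delta> < real N * \<delta>" and L: "enat N \<le> L"
  shows "\<exists>s \<eta>best fbest. algorithm2 X Us sol \<eta>0 \<delta> L = Some (s, \<eta>best, fbest) \<and>
    P_optimal X a k (s, Us s)"
proof -
  \<comment> \<open>The first iteration is split off because the invariant fails in the initial
    state.\<close>
  obtain st1 where st1: "iteration X Us sol \<delta> (initial_state \<eta>0) = Some st1" "loop_inv \<delta> \<eta>0 st1"
    using first_iteration[of sol, OF sol \<delta> \<eta>0] by blast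
  obtain st where st: "algorithm2_loop X Us sol \<delta> L st1 = Some st" "loop_inv \<delta> \<eta>0 st"
    "infeasible st"
    using algorithm2_loop_result[OF N L st1(2)] by blast
  have "algorithm2_loop X Us sol \<delta> L (initial_state \<eta>0) = Some st"
    using running_initial st1(1) st(1) by (subst algorithm2_loop.simps) simp
  then have "algorithm2 X Us sol \<eta>0 \<delta> L
      = Some (best_support st, best_param st, \<pi> (best_support st))"
    using st(2) by (simp add: algorithm2_def loop_inv_def)
  moreover have "P_optimal X a k (best_support st, Us (best_support st))"
    using st(2,3) sep by (intro P_optimal_if_captured_max) (auto simp: loop_inv_def)
  ultimately show ?thesis by blast
qed

end

end

theorem proposition10:
  fixes X :: "real mat" and n p a k :: nat
    and Us :: "real vec \<Rightarrow> real mat"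
  assumes "X \<in> carrier_mat n p" and "centered X"
    and "0 < a" and "a \<le> n" and "0 < k" and "k \<le> p"
    and "best_frames X a Us"
  shows
    "(\<exists>\<eta>bar\<ge>0. \<forall>\<eta>0\<ge>\<eta>bar. \<forall>\<delta>>0. \<forall>L::enat.
        \<forall>sol. (\<forall>t. phi_solver X k (sol t)) \<longrightarrow>
          (\<exists>v :: nat \<Rightarrow> real.
             (\<forall>m. best_value_after X Us sol \<eta>0 \<delta> L (Suc m) = Some (v m)) \<and> convergent v))
     \<and>
     (\<exists>\<delta>0>0. \<exists>\<eta>bar\<ge>0. \<forall>\<delta>\<in>{0<..\<delta>0}. \<forall>\<eta>0\<ge>\<eta>bar. \<exists>L0::nat. \<forall>L\<ge>enat L0.
        \<forall>sol. (\<forall>t. phi_solver X k (sol t)) \<longrightarrow>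
          (\<exists>s \<eta>best fbest. algorithm2 X Us sol \<eta>0 \<delta> L = Some (s, \<eta>best, fbest) \<and>
             P_optimal X a k (s, Us s)))"
proof -
  interpret frames X a k Us by unfold_locales fact
  \<comment> \<open>The total squared norm of the columns serves as \<open>\<eta>bar\<close> in both
    parts.\<close>
  define B where "B = (\<Sum>i<dim_col X. col X i \<bullet> col X i)"
  have B: "0 \<le> B" unfolding B_def by (auto simp: scalar_prod_def intro!: sum_nonneg)
  obtain \<delta>0 where \<delta>0: "0 < \<delta>0" "\<And>\<delta>. \<delta> \<in> {0<..\<delta>0} \<Longrightarrow> separates_residuals \<delta>"
    using separates_residuals_small by blast
  show ?thesis
  proof (intro conjI)
    show "\<exists>\<eta>bar\<ge>0. \<forall>\<eta>0\<ge>\<eta>bar. \<forall>\<delta>>0. \<forall>L::enat.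
        \<forall>sol. (\<forall>t. phi_solver X k (sol t)) \<longrightarrow>
          (\<exists>v :: nat \<Rightarrow> real.
             (\<forall>m. best_value_after X Us sol \<eta>0 \<delta> L (Suc m) = Some (v m)) \<and> convergent v)"
    proof (rule exI[of _ B], intro conjI allI impI)
      fix \<eta>0 \<delta> :: real and L :: enat and sol :: "nat \<Rightarrow> nat set set \<Rightarrow> real vec option"
      assume "B \<le> \<eta>0" "0 < \<delta>" "\<forall>t. phi_solver X k (sol t)"
      then show "\<exists>v. (\<forall>m. best_value_after X Us sol \<eta>0 \<delta> L (Suc m) = Some (v m)) \<and> convergent v"
        by (intro best_value_convergent) (auto simp: B_def)
    qed (fact B)
    show "\<exists>\<delta>0>0. \<exists>\<eta>bar\<ge>0. \<forall>\<delta>\<in>{0<..\<delta>0}. \<forall>\<eta>0\<ge>\<eta>bar. \<exists>L0::nat. \<forall>L\<ge>enat L0.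
        \<forall>sol. (\<forall>t. phi_solver X k (sol t)) \<longrightarrow>
          (\<exists>s \<eta>best fbest. algorithm2 X Us sol \<eta>0 \<delta> L = Some (s, \<eta>best, fbest) \<and>
             P_optimal X a k (s, Us s))"
    proof (rule exI[of _ \<delta>0], intro conjI exI[of _ B] ballI allI impI)
      fix \<delta> \<eta>0 :: real assume \<delta>: "\<delta> \<in> {0<..\<delta>0}" and \<eta>0: "B \<le> \<eta>0"
      \<comment> \<open>By the Archimedean property; \<open>N\<close> is chosen from
        \<open>\<eta>0\<close> and \<delta> alone and thus works for all solvers at once.\<close>
      then obtain N :: nat where N: "\<eta>0 + \<delta> < real N * \<delta>"
        using ex_less_of_nat_mult[of \<delta> "\<eta>0 + \<delta>"] by auto
      show "\<exists>L0::nat. \<forall>L\<ge>enat L0. \<forall>sol. (\<forall>t. phi_solver X k (sol t)) \<longrightarrow>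
          (\<exists>s \<eta>best fbest. algorithm2 X Us sol \<eta>0 \<delta> L = Some (s, \<eta>best, fbest) \<and>
             P_optimal X a k (s, Us s))"
      proof (intro exI[of _ N] allI impI)
        fix L :: enat and sol :: "nat \<Rightarrow> nat set set \<Rightarrow> real vec option"
        assume L: "enat N \<le> L" and sol: "\<forall>t. phi_solver X k (sol t)"
        show "\<exists>s \<eta>best fbest. algorithm2 X Us sol \<eta>0 \<delta> L = Some (s, \<eta>best, fbest) \<and>
             P_optimal X a k (s, Us s)"
          using \<delta> \<eta>0 sol by (intro algorithm2_optimal[OF _ _ _ \<delta>0(2)[OF \<delta>] N L]) (auto simp: B_def)
      qed
    qed (use \<delta>0 B in auto)
  qed
qed

end
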